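(* Let $r\in(0,1)$ and let $\mu$ be a growth rate with $\mu\prec\mathrm{u}_r$. Then the maps $t\mapsto\limsup_{\tau\to\pm\infty}\mu_\tau(t)$ and $t\mapsto\liminf_{\tau\to\pm\infty}\mu_\tau(t)$ (for each of the two choices $\tau\to+\infty$ and $\tau\to-\infty$), defined on $\mathbb{R}$, are bounded and bounded away from zero.
   Context: A growth rate is a strictly increasing differentiable function $\mu:\mathbb{R}\to\mathbb{R}^+$ with $\mu(0)=1$, $\lim_{t\to+\infty}\mu(t)=+\infty$, $\lim_{t\to-\infty}\mu(t)=0$. For $\tau\in\mathbb{R}$, its $\tau$-translation is $\mu_\tau(t)=\mu(t+\tau)/\mu(\tau)$. For $r\in(0,1)$, $\mathrm{u}_r(t)=e^{\mathrm{sgn}(t)((|t|+1)^r-1)}$ is the subexponential growth rate. For growth rates $\sigma,\mu$, $\sigma\prec\mu$ ($\sigma$ weakly slower than $\mu$) means that there is $M\ge1$ with $\frac{\sigma(t)}{\sigma(s)}\le M\frac{\mu(t)}{\mu(s)}$ for all $t\ge s$. *)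

theory Defs
  imports Complex_Main "HOL-Library.Extended_Real"
begin

definition growth_rate :: "(real \<Rightarrow> real) \<Rightarrow> bool" where
  "growth_rate \<mu> \<longleftrightarrow>
     (\<forall>t. 0 < \<mu> t) \<and>
     strict_mono \<mu> \<and>
     (\<forall>t. \<mu> differentiable (at t)) \<and>
     \<mu> 0 = 1 \<and>
     filterlim \<mu> at_top at_top \<and>
     (\<mu> \<longlongrightarrow> 0) at_bot"

definition translation :: "(real \<Rightarrow> real) \<Rightarrow> real \<Rightarrow> real \<Rightarrow> real" where
  "translation \<mu> \<tau> t = \<mu> (t + \<tau>) / \<mu> \<tau>"

definition subexp_rate :: "real \<Rightarrow> real \<Rightarrow> real" where
  "subexp_rate r t = exp (sgn t * ((\<bar>t\<bar> + 1) powr r - 1))"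

definition weakly_slower :: "(real \<Rightarrow> real) \<Rightarrow> (real \<Rightarrow> real) \<Rightarrow> bool" where
  "weakly_slower \<sigma> \<mu> \<longleftrightarrow>
     (\<exists>M\<ge>1. \<forall>s t. s \<le> t \<longrightarrow> \<sigma> t / \<sigma> s \<le> M * (\<mu> t / \<mu> s))"

(* Upper and lower limits of real functions are taken in ereal, where they always
   exist; the bounds below are required to be real numbers, so boundedness of such
   a map includes its finiteness (bdd_above would hold trivially in ereal). *)

definition ereal_bounded :: "(real \<Rightarrow> ereal) \<Rightarrow> bool" where
  "ereal_bounded f \<longleftrightarrow> (\<exists>C::real. \<forall>t. \<bar>f t\<bar> \<le> ereal C)"

definition ereal_bounded_away_from_zero :: "(real \<Rightarrow> ereal) \<Rightarrow> bool" where
  "ereal_bounded_away_from_zero f \<longleftrightarrow> (\<exists>c::real. c > 0 \<and> (\<forall>t. ereal c \<le> \<bar>f t\<bar>))"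

definition upper_translation :: "real filter \<Rightarrow> (real \<Rightarrow> real) \<Rightarrow> real \<Rightarrow> ereal" where
  "upper_translation F \<mu> t = Limsup F (\<lambda>\<tau>. ereal (translation \<mu> \<tau> t))"

definition lower_translation :: "real filter \<Rightarrow> (real \<Rightarrow> real) \<Rightarrow> real \<Rightarrow> ereal" where
  "lower_translation F \<mu> t = Liminf F (\<lambda>\<tau>. ereal (translation \<mu> \<tau> t))"

end

theory Submission
  imports Defs "HOL-Real_Asymp.Real_Asymp"
begin

text \<open>
  For fixed \<open>t\<close> the difference \<open>(\<bar>\<tau> + t\<bar> + 1) powr r - (\<bar>\<tau>\<bar> + 1) powr r\<close> vanishes as
  \<open>\<tau> \<rightarrow> \<plusminus>\<infinity>\<close> because \<open>r < 1\<close>, so the translations of the subexponential rate tend to \<open>1\<close>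
  pointwise. If \<open>M\<close> is the constant in the comparison of \<open>\<mu>\<close> with that rate, then by
  monotonicity the translations of \<open>\<mu>\<close> at \<open>t\<close> eventually lie between \<open>1/(2M)\<close> and \<open>2M\<close>,
  and these bounds do not depend on \<open>t\<close>.
\<close>

lemma translation_subexp_rate_at_top:
  assumes "0 < r" "r < 1"
  shows "((\<lambda>\<tau>. translation (subexp_rate r) \<tau> t) \<longlongrightarrow> 1) at_top"
proof -
  have "((\<lambda>\<tau>::real. exp ((t + \<tau> + 1) powr r - (\<tau> + 1) powr r)) \<longlongrightarrow> 1) at_top"
    using assms by real_asymp
  moreover have "eventually (\<lambda>\<tau>. exp ((t + \<tau> + 1) powr r - (\<tau> + 1) powr r) =
      translation (subexp_rate r) \<tau> t) at_top"
    \<comment> \<open>Beyond \<open>\<bar>t\<bar>\<close> both \<open>\<tau>\<close> and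
      \<open>t + \<tau>\<close> are positive, so signs and absolute values drop out and the two
      \<open>- 1\<close> cancel.\<close>
    using eventually_gt_at_top[of "\<bar>t\<bar>"]
    by eventually_elim (auto simp: translation_def subexp_rate_def exp_diff [symmetric])
  ultimately show ?thesis
    by (rule Lim_transform_eventually)
qed

text \<open>The exponent is odd in \<open>t\<close>. This symmetry carries the limit at
  \<open>at_top\<close> over to \<open>at_bot\<close>.\<close>

lemma subexp_rate_uminus: "subexp_rate r (- t) = inverse (subexp_rate r t)"
  by (simp add: subexp_rate_def sgn_minus exp_minus [symmetric])

lemma translation_subexp_rate_at_bot:
  assumes "0 < r" "r < 1"
  shows "((\<lambda>\<tau>. translation (subexp_rate r) \<tau> t) \<longlongrightarrow> 1) at_bot"
proof -
  have "translation (subexp_rate r) (- \<tau>) t = inverse (translation (subexp_rate r) \<tau> (- t))" for \<tau>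
    using subexp_rate_uminus[of r \<tau>] subexp_rate_uminus[of r "- t + \<tau>"]
    by (simp add: translation_def field_simps)
  then show ?thesis
    using tendsto_inverse[OF translation_subexp_rate_at_top[OF assms, of "- t"]]
    by (simp add: filterlim_at_bot_mirror)
qed

text \<open>The comparison bounds the growth of \<open>\<mu>\<close> only from above. For
  \<open>t \<ge> 0\<close> this gives the upper bound, and monotonicity gives the lower bound 1; for
  \<open>t < 0\<close> the roles swap after taking reciprocals.\<close>

lemma eventually_translation_bounds:
  assumes \<mu>: "\<And>t. 0 < \<mu> t" "mono \<mu>"
    and \<sigma>: "\<And>t. 0 < \<sigma> t" "\<And>t. ((\<lambda>\<tau>. translation \<sigma> \<tau> t) \<longlongrightarrow> 1) F"
    and M: "M \<ge> 1" "\<And>s t. s \<le> t \<Longrightarrow> \<mu> t / \<mu> s \<le> M * (\<sigma> t / \<sigma> s)"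
  shows "eventually (\<lambda>\<tau>. 1 / (2 * M) \<le> translation \<mu> \<tau> t \<and> translation \<mu> \<tau> t \<le> 2 * M) F"
proof -
  \<comment> \<open>The limit 1 leaves room for a factor 2 on either side, which is the 2 in
    \<open>2 * M\<close>.\<close>
  have "eventually (\<lambda>\<tau>. translation \<sigma> \<tau> t < 2) F" "eventually (\<lambda>\<tau>. 1 / 2 < translation \<sigma> \<tau> t) F"
    by (rule order_tendstoD[OF \<sigma>(2)[of t]]; simp)+
  then show ?thesis
  proof eventually_elim
    case (elim \<tau>)
    \<comment> \<open>The target interval contains 1, so the bound by 1 from monotonicity suffices
      on the other side.\<close>
    have inv: "1 / (2 * M) \<le> 1" "1 \<le> 2 * M"
      using M(1) by auto
    show ?case
    proof (cases "0 \<le> t")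
      case True
      have "translation \<mu> \<tau> t \<le> M * translation \<sigma> \<tau> t"
        using M(2)[of \<tau> "t + \<tau>"] True by (simp add: translation_def)
      also have "\<dots> \<le> M * 2"
        using elim M(1) by (intro mult_left_mono) auto
      finally have "translation \<mu> \<tau> t \<le> 2 * M"
        by simp
      moreover have "1 \<le> translation \<mu> \<tau> t"
        using \<mu> True by (simp add: translation_def monoD)
      ultimately show ?thesis
        using inv by linarith
    next
      case False
      have pos: "0 < translation \<mu> \<tau> t" "0 < translation \<sigma> \<tau> t"
        using \<mu>(1) \<sigma>(1) by (simp_all add: translation_def)
      \<comment> \<open>Now \<open>\<tau>\<close> is the right endpoint, so the comparison controls
        the reciprocal.\<close>
      have "inverse (translation \<mu> \<tau> t) \<le> M * inverse (translation \<sigma> \<tau> t)"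
        using M(2)[of "t + \<tau>" \<tau>] False by (simp add: translation_def)
      also have "\<dots> \<le> M * 2"
        using elim M(1) pos by (intro mult_left_mono) (auto simp: field_simps)
      finally have "1 / (2 * M) \<le> translation \<mu> \<tau> t"
        using pos M(1) by (simp add: field_simps)
      moreover have "translation \<mu> \<tau> t \<le> 1"
        using \<mu> False by (simp add: translation_def monoD)
      ultimately show ?thesis
        using inv by linarith
    qed
  qed
qed

lemma ereal_boundedI:
  assumes "\<And>t. 0 \<le> f t" "\<And>t. f t \<le> ereal C"
  shows "ereal_bounded f"
  using assms unfolding ereal_bounded_def by auto

lemma ereal_bounded_away_from_zeroI:
  assumes "0 < c" "\<And>t. ereal c \<le> f t"
  shows "ereal_bounded_away_from_zero f"
proof -
  have "0 \<le> f t" for t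
    using assms(1) by (intro order_trans[OF _ assms(2)]) simp
  then show ?thesis
    using assms unfolding ereal_bounded_away_from_zero_def by auto
qed

text \<open>How far out \<open>ev\<close> starts to hold may depend on \<open>t\<close>; only
  \<open>c\<close> and \<open>C\<close> must be uniform. Two of the four bounds are direct, and the
  other two follow from Liminf \<le> Limsup, where \<open>F \<noteq> bot\<close> enters.\<close>

lemma upper_lower_translation_bounded:
  assumes "F \<noteq> bot" "0 < c"
    and ev: "\<And>t. eventually (\<lambda>\<tau>. c \<le> translation \<mu> \<tau> t \<and> translation \<mu> \<tau> t \<le> C) F"
  shows "ereal_bounded (upper_translation F \<mu>) \<and>
         ereal_bounded_away_from_zero (upper_translation F \<mu>) \<and>
         ereal_bounded (lower_translation F \<mu>) \<and>
         ereal_bounded_away_from_zero (lower_translation F \<mu>)"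
proof -
  have lower: "ereal c \<le> lower_translation F \<mu> t" for t
    unfolding lower_translation_def using ev[of t]
    by (intro Liminf_bounded) (auto elim: eventually_mono)
  have upper: "upper_translation F \<mu> t \<le> ereal C" for t
    unfolding upper_translation_def using ev[of t]
    by (intro Limsup_bounded) (auto elim: eventually_mono)
  have mid: "lower_translation F \<mu> t \<le> upper_translation F \<mu> t" for t
    unfolding lower_translation_def upper_translation_def
    by (rule Liminf_le_Limsup) fact
  have upper': "ereal c \<le> upper_translation F \<mu> t" for t
    using lower mid by (rule order_trans)
  have lower': "lower_translation F \<mu> t \<le> ereal C" for t
    using mid upper by (rule order_trans)
  have c: "0 \<le> ereal c"
    using \<open>0 < c\<close> by simp
  show ?thesis
    by (intro conjI ereal_boundedI[OF order_trans[OF c upper'] upper]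
        ereal_boundedI[OF order_trans[OF c lower] lower']
        ereal_bounded_away_from_zeroI[OF \<open>0 < c\<close> upper']
        ereal_bounded_away_from_zeroI[OF \<open>0 < c\<close> lower])
qed

theorem lemma3p4:
  fixes r :: real and \<mu> :: "real \<Rightarrow> real"
  assumes "0 < r" and "r < 1"
    and "growth_rate \<mu>"
    and "weakly_slower \<mu> (subexp_rate r)"
  shows "\<forall>F \<in> {at_top, at_bot}.
           ereal_bounded (upper_translation F \<mu>) \<and>
           ereal_bounded_away_from_zero (upper_translation F \<mu>) \<and>
           ereal_bounded (lower_translation F \<mu>) \<and>
           ereal_bounded_away_from_zero (lower_translation F \<mu>)"
proof
  fix F :: "real filter"
  assume F: "F \<in> {at_top, at_bot}"
  then consider "F = at_top" | "F = at_bot"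
    by blast
  then have "F \<noteq> bot"
    by cases (simp_all only: trivial_limit_at_top_linorder trivial_limit_at_bot_linorder
        not_False_eq_True)
  obtain M where M: "M \<ge> 1"
      "\<And>s t. s \<le> t \<Longrightarrow> \<mu> t / \<mu> s \<le> M * (subexp_rate r t / subexp_rate r s)"
    using assms(4) unfolding weakly_slower_def by blast
  have \<mu>: "0 < \<mu> t" "mono \<mu>" for t
    using assms(3) by (auto simp: growth_rate_def strict_mono_mono)
  have lim: "((\<lambda>\<tau>. translation (subexp_rate r) \<tau> t) \<longlongrightarrow> 1) F" for t
    using F translation_subexp_rate_at_top translation_subexp_rate_at_bot assms(1,2) by blast
  have pos: "0 < subexp_rate r t" for t
    by (simp add: subexp_rate_def)
  show "ereal_bounded (upper_translation F \<mu>) \<and>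
        ereal_bounded_away_from_zero (upper_translation F \<mu>) \<and>
        ereal_bounded (lower_translation F \<mu>) \<and>
        ereal_bounded_away_from_zero (lower_translation F \<mu>)"
    \<comment> \<open>Here \<open>c\<close> is \<open>1 / (2 * M)\<close> and \<open>C\<close> is
      \<open>2 * M\<close>; positivity of \<open>c\<close> comes from
      \<open>M \<ge> 1\<close>.\<close>
    using M(1) by (intro upper_lower_translation_bounded[OF \<open>F \<noteq> bot\<close> _
      eventually_translation_bounds[OF \<mu> pos lim M]]) auto
qed

end
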